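(* Let $D\in\{2,3\}$, let $d,k\geq 1$ be integers, and put $p_d := 1-\frac{1}{d^{D-1}}$. Let $k$ particles be placed independently and uniformly at random into the $d^D$ cells (several particles may occupy the same cell), and let $X$ be the random number of zero measurements, i.e. the number of rays that are incident with no occupied cell. Let $N_R^0=\mathbb{E}[X] = D d^{D-1}\, p_d^{k}$. Then, for any $\delta>0$, $$\Pr\big(|X-N_R^0|\geq \delta\big)\;\leq\; 2\exp\bigg(-\frac{1-p_d^2}{1-p_d^{2k}}\;\frac{\delta^2}{2D^2}\bigg),$$ and, for fixed $k$ and $\delta$, the right-hand side increases to $2\exp\big(-\frac{\delta^2}{2D^2k}\big)$ as $d\to\infty$.
   Context: Cells are the elements of $C=\{1,\dots,d\}^D$, so $|C|=d^D$. Rays are the axis-parallel lines of cells: for each of the $D$ coordinate directions and each choice of the remaining $D-1$ coordinates in $\{1,\dots,d\}^{D-1}$ there is one ray, consisting of (incident with) the $d$ cells that have these remaining coordinates. Thus the set $R$ of rays has $|R|=D d^{D-1}$ elements, and each cell is incident with exactly $D$ rays, one per direction. A ray is a zero measurement if no particle lies in any of its cells. *)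

theory Defs
  imports "HOL-Probability.Probability"
begin

text \<open>A cell is an extensional coordinate vector indexed by \<open>{1..D}\<close>.\<close>

definition cells :: "nat \<Rightarrow> nat \<Rightarrow> (nat \<Rightarrow> nat) set" where
  "cells D d = {1..D} \<rightarrow>\<^sub>E {1..d}"

text \<open>
  A ray is a direction \<open>i\<close> together with the remaining \<open>D - 1\<close> coordinates.  It is not
  identified with its set of cells: for \<open>d = 1\<close> the rays of different directions have the
  same cells but count as different rays.
\<close>

definition rays :: "nat \<Rightarrow> nat \<Rightarrow> (nat \<times> (nat \<Rightarrow> nat)) set" where
  "rays D d = (SIGMA i:{1..D}. ({1..D} - {i}) \<rightarrow>\<^sub>E {1..d})"

definition ray_cells :: "nat \<Rightarrow> nat \<Rightarrow> nat \<times> (nat \<Rightarrow> nat) \<Rightarrow> (nat \<Rightarrow> nat) set" where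
  "ray_cells D d r = {c \<in> cells D d. \<forall>j\<in>{1..D} - {fst r}. c j = snd r j}"

text \<open>A placement \<open>z\<close> puts particle \<open>n < k\<close> into cell \<open>z n\<close>.\<close>

definition occupied :: "nat \<Rightarrow> (nat \<Rightarrow> nat \<Rightarrow> nat) \<Rightarrow> (nat \<Rightarrow> nat) set" where
  "occupied k z = z ` {..<k}"

definition zero_measurements ::
    "nat \<Rightarrow> nat \<Rightarrow> nat \<Rightarrow> (nat \<Rightarrow> nat \<Rightarrow> nat) \<Rightarrow> (nat \<times> (nat \<Rightarrow> nat)) set" where
  "zero_measurements D d k z = {r \<in> rays D d. ray_cells D d r \<inter> occupied k z = {}}"

definition num_zero :: "nat \<Rightarrow> nat \<Rightarrow> nat \<Rightarrow> (nat \<Rightarrow> nat \<Rightarrow> nat) \<Rightarrow> real" where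
  "num_zero D d k z = real (card (zero_measurements D d k z))"

text \<open>
  The product measure makes the \<open>k\<close> uniform particle positions independent; the value
  \<open>undefined\<close> is only taken at indices \<open>n \<ge> k\<close>, which stand for no particle.
\<close>

definition placement_pmf :: "nat \<Rightarrow> nat \<Rightarrow> nat \<Rightarrow> (nat \<Rightarrow> nat \<Rightarrow> nat) pmf" where
  "placement_pmf D d k = Pi_pmf {..<k} undefined (\<lambda>_. pmf_of_set (cells D d))"

definition expected_zero :: "nat \<Rightarrow> nat \<Rightarrow> nat \<Rightarrow> real" where
  "expected_zero D d k = measure_pmf.expectation (placement_pmf D d k) (num_zero D d k)"

definition miss_prob :: "nat \<Rightarrow> nat \<Rightarrow> real" where
  "miss_prob D d = 1 - 1 / real d ^ (D - 1)"

definition tail_bound :: "nat \<Rightarrow> nat \<Rightarrow> real \<Rightarrow> nat \<Rightarrow> real" where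
  "tail_bound D k \<delta> d =
     2 * exp (- ((1 - miss_prob D d ^ 2) / (1 - miss_prob D d ^ (2 * k)) *
                 (\<delta> ^ 2 / (2 * real D ^ 2))))"

lemma card_cells: "card (cells D d) = d ^ D"
  by (simp add: cells_def card_PiE)

lemma card_rays: "card (rays D d) = D * d ^ (D - 1)"
  by (simp add: rays_def card_SigmaI finite_PiE card_PiE)

end

theory Submission
  imports Defs
begin

text \<open>
  Write \<open>X\<^sub>k\<close> for the number of zero measurements of \<open>k\<close> particles, \<open>p\<close> for
  \<^term>\<open>miss_prob D d\<close> and \<open>c\<close> for the mean of \<open>X\<^sub>0\<close>.  Given the first \<open>k\<close> particles, the
  conditional mean of \<open>X\<^sub>k\<^sub>+\<^sub>1\<close> is \<open>p X\<^sub>k\<close>, and \<open>X\<^sub>k\<^sub>+\<^sub>1\<close> lies in an interval of length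
  \<open>D\<close> because a new particle meets only \<open>D\<close> rays.  Conditioning on the last particle and
  applying Hoeffding's lemma therefore turns a bound on the moment generating function of
  \<open>X\<^sub>k - c p\<^sup>k\<close> at \<open>l p\<close> into one of \<open>X\<^sub>k\<^sub>+\<^sub>1 - c p\<^sup>k\<^sup>+\<^sup>1\<close> at \<open>l\<close>, at the cost of a
  factor \<open>exp (l\<^sup>2 D\<^sup>2 / 8)\<close>; this is the Azuma-Hoeffding argument for the martingale of
  conditional expectations of \<open>X\<^sub>k\<close>.  The variance proxy is the geometric sum of the
  \<open>p\<^sup>2\<^sup>j\<close> with \<open>j < k\<close>, which is increasing in \<open>p\<close> and hence in \<open>d\<close>.
\<close>

section \<open>Finitely supported distributions\<close>

lemma expectation_bind_pmf_finite:
  fixes h :: "'b \<Rightarrow> real"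
  assumes "finite (set_pmf p)" and "\<And>x. x \<in> set_pmf p \<Longrightarrow> finite (set_pmf (f x))"
  shows "measure_pmf.expectation (bind_pmf p f) h =
         measure_pmf.expectation p (\<lambda>x. measure_pmf.expectation (f x) h)"
  using assms
  by (subst pmf_expectation_bind[where A = "set_pmf p"])
     (auto simp: integral_measure_pmf_real[OF assms(1)] mult.commute intro!: sum.cong)

text \<open>All real \<open>l\<close> are covered: the two-sided tail uses \<open>l\<close> and
  \<open>-l\<close>, and the induction on the particles evaluates at
  \<open>l * miss_prob D d\<close>, which is 0 for \<open>d = 1\<close>.\<close>

lemma Hoeffdings_lemma_finite_pmf:
  fixes f :: "'a \<Rightarrow> real"
  assumes fin: "finite (set_pmf q)" and bd: "\<And>x. x \<in> set_pmf q \<Longrightarrow> f x \<in> {a..b}"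
  shows "measure_pmf.expectation q (\<lambda>x. exp (l * (f x - measure_pmf.expectation q f)))
         \<le> exp (l\<^sup>2 * (b - a)\<^sup>2 / 8)"
proof -
  have pos: "measure_pmf.expectation q (\<lambda>x. exp (l * (f x - measure_pmf.expectation q f)))
             \<le> exp (l\<^sup>2 * (b - a)\<^sup>2 / 8)"
    if "l > 0" and bd: "\<And>x. x \<in> set_pmf q \<Longrightarrow> f x \<in> {a..b}" for l a b and f :: "'a \<Rightarrow> real"
  proof -
    have eq: "(\<integral>\<^sup>+x. ennreal (exp (l * (f x - \<mu>))) \<partial>q) =
              ennreal (measure_pmf.expectation q (\<lambda>x. exp (l * (f x - \<mu>))))" for \<mu>
      by (rule nn_integral_eq_integral) (auto intro: integrable_measure_pmf_finite fin)
    interpret interval_bounded_random_variable "measure_pmf q" f a b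
      by unfold_locales (auto simp: AE_measure_pmf_iff dest: bd)
    show ?thesis using Hoeffdings_lemma_nn_integral[OF \<open>l > 0\<close>] by (simp add: eq)
  qed
  consider "l > 0" | "l = 0" | "l < 0" by linarith
  thus ?thesis
  proof cases
    case 1
    thus ?thesis using bd by (rule pos)
  next
    case 2
    thus ?thesis by simp
  next
    case 3
    \<comment> \<open>Negative \<open>l\<close> is the positive case for \<open>- f\<close>, whose
      values lie in \<open>{- b..- a}\<close>.\<close>
    have "measure_pmf.expectation q
            (\<lambda>x. exp (- l * (- f x - measure_pmf.expectation q (\<lambda>x. - f x))))
          \<le> exp ((- l)\<^sup>2 * (- a - - b)\<^sup>2 / 8)"
      using 3 bd by (intro pos) auto
    moreover have "- l * (- f x - measure_pmf.expectation q (\<lambda>x. - f x)) =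
                   l * (f x - measure_pmf.expectation q f)" for x
      by (simp add: algebra_simps)
    ultimately show ?thesis by simp
  qed
qed

text \<open>Chernoff's method; \<open>l = 4 \<delta> / v\<close> minimises the exponent \<open>l\<^sup>2 v / 8 - l \<delta>\<close>.\<close>

lemma sub_Gaussian_tail_finite_pmf:
  fixes Y :: "'a \<Rightarrow> real"
  assumes fin: "finite (set_pmf q)" and v: "v > 0" and \<delta>: "\<delta> > 0"
    and mgf: "\<And>l. measure_pmf.expectation q (\<lambda>z. exp (l * Y z)) \<le> exp (l\<^sup>2 * v / 8)"
  shows "measure_pmf.prob q {z. \<bar>Y z\<bar> \<ge> \<delta>} \<le> 2 * exp (- (2 * \<delta>\<^sup>2 / v))"
proof -
  define l where "l = 4 * \<delta> / v"
  have l: "l > 0" using v \<delta> by (simp add: l_def)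
  have int: "integrable (measure_pmf q) h" for h :: "'a \<Rightarrow> real"
    by (rule integrable_measure_pmf_finite) (rule fin)
  \<comment> \<open>Adding both exponentials handles the two tails with one use of Markov's
    inequality; the factor 2 comes from here.\<close>
  let ?u = "\<lambda>z. exp (l * Y z) + exp (-l * Y z)"
  have "{z. \<bar>Y z\<bar> \<ge> \<delta>} \<subseteq> {z. ?u z \<ge> exp (l * \<delta>)}"
  proof safe
    fix z assume "\<bar>Y z\<bar> \<ge> \<delta>"
    hence "exp (l * \<delta>) \<le> exp (l * \<bar>Y z\<bar>)" using l by simp
    also have "\<dots> \<le> ?u z" by (cases "Y z \<ge> 0") auto
    finally show "?u z \<ge> exp (l * \<delta>)" .
  qed
  hence "measure_pmf.prob q {z. \<bar>Y z\<bar> \<ge> \<delta>} \<le> measure_pmf.prob q {z. ?u z \<ge> exp (l * \<delta>)}"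
    by (intro measure_pmf.finite_measure_mono) auto
  also have "\<dots> \<le> measure_pmf.expectation q ?u / exp (l * \<delta>)"
    using integral_Markov_inequality_measure[of "measure_pmf q" ?u UNIV "exp (l * \<delta>)"] int
    by simp
  also have "\<dots> \<le> (2 * exp (l\<^sup>2 * v / 8)) / exp (l * \<delta>)"
  proof (rule divide_right_mono)
    show "measure_pmf.expectation q ?u \<le> 2 * exp (l\<^sup>2 * v / 8)"
      using mgf[of l] mgf[of "-l"] by (subst Bochner_Integration.integral_add) (auto intro: int)
  qed simp
  also have "\<dots> = 2 * exp (l\<^sup>2 * v / 8 - l * \<delta>)" by (simp add: exp_diff)
  also have "l\<^sup>2 * v / 8 - l * \<delta> = - (2 * \<delta>\<^sup>2 / v)"
    using v by (simp add: l_def field_simps power2_eq_square)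
  finally show ?thesis .
qed

section \<open>Incidences of cells and rays\<close>

lemma finite_cells [simp]: "finite (cells D d)"
  by (simp add: cells_def finite_PiE)

lemma cells_nonempty: "d \<ge> 1 \<Longrightarrow> cells D d \<noteq> {}"
  by (simp add: cells_def PiE_eq_empty_iff)

lemma finite_rays [simp]: "finite (rays D d)"
  by (auto simp: rays_def intro!: finite_PiE)

lemma card_ray_cells:
  assumes "r \<in> rays D d"
  shows "card (ray_cells D d r) = d"
proof -
  obtain i g where r: "r = (i, g)" by (cases r)
  have i: "i \<in> {1..D}" and g: "g \<in> ({1..D} - {i}) \<rightarrow>\<^sub>E {1..d}"
    using assms by (auto simp: rays_def r)
  \<comment> \<open>The free coordinate parametrises the ray.\<close>
  have "bij_betw (\<lambda>x. g(i := x)) {1..d} (ray_cells D d r)"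
  proof (rule bij_betw_byWitness[where f' = "\<lambda>c. c i"])
    show "\<forall>c\<in>ray_cells D d r. g(i := c i) = c"
    proof
      fix c assume "c \<in> ray_cells D d r"
      hence c: "c \<in> cells D d" "\<And>j. j \<in> {1..D} - {i} \<Longrightarrow> c j = g j"
        by (auto simp: ray_cells_def r)
      show "g(i := c i) = c"
      proof
        fix j
        show "(g(i := c i)) j = c j"
        proof (cases "j \<in> {1..D}")
          case True
          thus ?thesis using c(2)[of j] by auto
        next
          \<comment> \<open>Off \<open>{1..D}\<close> equality rests on extensionality.\<close>
          case False
          hence "j \<noteq> i" using i by auto
          moreover have "c j = undefined"
            using c(1) False unfolding cells_def by (rule PiE_arb)
          moreover have "g j = undefined" by (rule PiE_arb[OF g]) (use False in auto)
          ultimately show ?thesis by simp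
        qed
      qed
    qed
    show "(\<lambda>x. g(i := x)) ` {1..d} \<subseteq> ray_cells D d r"
    proof safe
      fix x assume "x \<in> {1..d}"
      hence "g(i := x) \<in> insert i ({1..D} - {i}) \<rightarrow>\<^sub>E {1..d}"
        by (rule PiE_fun_upd[OF _ g])
      hence "g(i := x) \<in> cells D d"
        using i by (simp add: cells_def insert_absorb)
      thus "g(i := x) \<in> ray_cells D d r" by (simp add: ray_cells_def r)
    qed
    show "(\<lambda>c. c i) ` ray_cells D d r \<subseteq> {1..d}"
      using i by (auto simp: ray_cells_def cells_def PiE_iff)
  qed auto
  from bij_betw_same_card[OF this] show ?thesis by simp
qed

text \<open>A ray through \<open>c\<close> takes its fixed coordinates from \<open>c\<close>, so its
  direction determines it.\<close>

lemma card_rays_through_le: "card {r \<in> rays D d. c \<in> ray_cells D d r} \<le> D"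
proof -
  have "{r \<in> rays D d. c \<in> ray_cells D d r}
        \<subseteq> (\<lambda>i. (i, restrict c ({1..D} - {i}))) ` {1..D}"
  proof
    fix r assume "r \<in> {r \<in> rays D d. c \<in> ray_cells D d r}"
    then obtain i g where r: "r = (i, g)" and i: "i \<in> {1..D}"
      and g: "g \<in> ({1..D} - {i}) \<rightarrow>\<^sub>E {1..d}" and c: "\<forall>j\<in>{1..D} - {i}. c j = g j"
      by (auto simp: rays_def ray_cells_def)
    have "g = restrict g ({1..D} - {i})"
      using g by (simp add: PiE_restrict)
    also have "\<dots> = restrict c ({1..D} - {i})"
      using c by (intro restrict_ext) auto
    finally show "r \<in> (\<lambda>i. (i, restrict c ({1..D} - {i}))) ` {1..D}"
      using i r by blast
  qed
  hence "card {r \<in> rays D d. c \<in> ray_cells D d r}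
         \<le> card ((\<lambda>i. (i, restrict c ({1..D} - {i}))) ` {1..D})"
    by (intro card_mono) auto
  also have "\<dots> \<le> card {1..D}" by (rule card_image_le) simp
  finally show ?thesis by simp
qed

text \<open>The right-hand side is the fraction of cells off a fixed ray, the form that double
  counting yields.\<close>

lemma miss_prob_eq:
  assumes "D \<ge> 1" and "d \<ge> 1"
  shows "miss_prob D d = (real d ^ D - real d) / real d ^ D"
  using assms by (cases D) (auto simp: miss_prob_def field_simps)

text \<open>Double counting of the pairs of a ray in \<open>A\<close> and a cell off it.\<close>

lemma expectation_rays_avoiding:
  assumes "A \<subseteq> rays D d" and D: "D \<ge> 1" and d: "d \<ge> 1"
  shows "measure_pmf.expectation (pmf_of_set (cells D d))
           (\<lambda>c. real (card {r \<in> A. c \<notin> ray_cells D d r})) = miss_prob D d * real (card A)"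
proof -
  have A: "finite A" using assms(1) finite_rays by (rule finite_subset)
  have le: "d \<le> d ^ D" using D d by (simp add: self_le_power)
  have "(\<Sum>c\<in>cells D d. card {r \<in> A. c \<notin> ray_cells D d r}) =
        (\<Sum>r\<in>A. card {c \<in> cells D d. c \<notin> ray_cells D d r})"
    by (rule sum_multicount_gen[symmetric]) (auto simp: A)
  also have "\<dots> = (\<Sum>r\<in>A. d ^ D - d)"
  proof (rule sum.cong)
    fix r assume r: "r \<in> A"
    have "{c \<in> cells D d. c \<notin> ray_cells D d r} = cells D d - ray_cells D d r" by auto
    moreover have "ray_cells D d r \<subseteq> cells D d" by (auto simp: ray_cells_def)
    moreover have "card (ray_cells D d r) = d" using r assms(1) by (auto intro: card_ray_cells)
    ultimately show "card {c \<in> cells D d. c \<notin> ray_cells D d r} = d ^ D - d"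
      by (simp add: card_Diff_subset finite_subset[OF _ finite_cells] card_cells)
  qed simp
  finally have "(\<Sum>c\<in>cells D d. card {r \<in> A. c \<notin> ray_cells D d r}) = card A * (d ^ D - d)"
    by simp
  hence "(\<Sum>c\<in>cells D d. real (card {r \<in> A. c \<notin> ray_cells D d r})) =
         real (card A) * (real d ^ D - real d)"
    using le by (simp flip: of_nat_sum add: of_nat_diff)
  thus ?thesis
    using D d by (simp add: integral_pmf_of_set cells_nonempty card_cells miss_prob_eq)
qed

section \<open>Adding one particle\<close>

text \<open>By independence the new particle can be drawn last; commuting the binds puts it there,
  so that one can condition on the others.\<close>

lemma placement_pmf_Suc:
  "placement_pmf D d (Suc k) =
     placement_pmf D d k \<bind> (\<lambda>z. map_pmf (\<lambda>c. z(k := c)) (pmf_of_set (cells D d)))"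
  unfolding placement_pmf_def lessThan_Suc
  by (subst Pi_pmf_insert', simp, simp, subst bind_commute_pmf) (simp add: map_pmf_def)

lemma finite_set_placement_pmf:
  assumes "d \<ge> 1"
  shows "finite (set_pmf (placement_pmf D d k))"
proof (induction k)
  case 0
  show ?case by (simp add: placement_pmf_def)
next
  case (Suc k)
  thus ?case using assms by (auto simp: placement_pmf_Suc cells_nonempty)
qed

lemma expectation_placement_Suc:
  fixes h :: "(nat \<Rightarrow> nat \<Rightarrow> nat) \<Rightarrow> real"
  assumes "d \<ge> 1"
  shows "measure_pmf.expectation (placement_pmf D d (Suc k)) h =
         measure_pmf.expectation (placement_pmf D d k)
           (\<lambda>z. measure_pmf.expectation (pmf_of_set (cells D d)) (\<lambda>c. h (z(k := c))))"
  unfolding placement_pmf_Suc using assms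
  by (subst expectation_bind_pmf_finite) (auto simp: finite_set_placement_pmf cells_nonempty)

lemma zero_measurements_Suc:
  "zero_measurements D d (Suc k) (z(k := c)) =
     {r \<in> zero_measurements D d k z. c \<notin> ray_cells D d r}"
  by (auto simp: zero_measurements_def occupied_def lessThan_Suc)

lemma finite_zero_measurements [simp]: "finite (zero_measurements D d k z)"
  by (simp add: zero_measurements_def)

lemma num_zero_0: "num_zero D d 0 z = real D * real d ^ (D - 1)"
  by (simp add: num_zero_def zero_measurements_def occupied_def card_rays)

text \<open>For any earlier placement \<open>z\<close>, the rays that are still empty serve as the
  set \<open>A\<close> of the double count.\<close>

lemma expectation_num_zero_step:
  assumes "D \<ge> 1" and "d \<ge> 1"
  shows "measure_pmf.expectation (pmf_of_set (cells D d)) (\<lambda>c. num_zero D d (Suc k) (z(k := c))) =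
         miss_prob D d * num_zero D d k z"
  unfolding num_zero_def zero_measurements_Suc
  using assms by (intro expectation_rays_avoiding) (auto simp: zero_measurements_def)

text \<open>The rays lost are empty rays through \<open>c\<close>. The interval depends on
  \<open>z\<close> but not on \<open>c\<close>, as Hoeffding's lemma requires.\<close>

lemma num_zero_step_bounds:
  "num_zero D d (Suc k) (z(k := c)) \<in> {num_zero D d k z - real D..num_zero D d k z}"
proof -
  let ?Z = "zero_measurements D d k z"
  let ?N = "{r \<in> ?Z. c \<notin> ray_cells D d r}" and ?H = "{r \<in> ?Z. c \<in> ray_cells D d r}"
  have "card ?H \<le> card {r \<in> rays D d. c \<in> ray_cells D d r}"
    by (intro card_mono) (auto simp: zero_measurements_def)
  hence "card ?H \<le> D" using card_rays_through_le by (rule le_trans)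
  moreover have "card ?Z = card ?N + card ?H"
  proof -
    have "?Z = ?N \<union> ?H" by auto
    hence "card ?Z = card (?N \<union> ?H)" by (rule arg_cong)
    also have "\<dots> = card ?N + card ?H" by (rule card_Un_disjoint) auto
    finally show ?thesis .
  qed
  ultimately show ?thesis by (simp add: num_zero_def zero_measurements_Suc)
qed

lemma expected_zero_eq:
  assumes "D \<ge> 1" and "d \<ge> 1"
  shows "expected_zero D d k = real D * real d ^ (D - 1) * miss_prob D d ^ k"
proof (induction k)
  case 0
  have "num_zero D d 0 = (\<lambda>z. real D * real d ^ (D - 1))"
    by (rule ext) (rule num_zero_0)
  thus ?case by (simp add: expected_zero_def)
next
  case (Suc k)
  have "expected_zero D d (Suc k) = miss_prob D d * expected_zero D d k"
    unfolding expected_zero_def expectation_placement_Suc[OF assms(2)]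
      expectation_num_zero_step[OF assms] by (rule integral_mult_right_zero)
  thus ?case by (simp add: Suc.IH)
qed

lemma mgf_num_zero_le:
  assumes D: "D \<ge> 1" and d: "d \<ge> 1"
  shows "measure_pmf.expectation (placement_pmf D d k)
           (\<lambda>z. exp (l * (num_zero D d k z - expected_zero D d k)))
         \<le> exp (l\<^sup>2 * ((real D)\<^sup>2 * (\<Sum>j<k. ((miss_prob D d)\<^sup>2) ^ j)) / 8)"
proof (induction k arbitrary: l)
  case 0
  show ?case using assms by (simp add: num_zero_0 expected_zero_eq)
next
  case (Suc k)
  let ?p = "miss_prob D d" and ?U = "pmf_of_set (cells D d)"
  let ?S = "\<lambda>k. \<Sum>j<k. (?p\<^sup>2) ^ j"
  let ?Y = "\<lambda>z. num_zero D d k z - expected_zero D d k"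
  have int: "integrable (measure_pmf (placement_pmf D d k)) h"
    for h :: "(nat \<Rightarrow> nat \<Rightarrow> nat) \<Rightarrow> real"
    by (rule integrable_measure_pmf_finite) (rule finite_set_placement_pmf[OF d])
  have step: "measure_pmf.expectation ?U
        (\<lambda>c. exp (l * (num_zero D d (Suc k) (z(k := c)) - expected_zero D d (Suc k))))
      \<le> exp (l\<^sup>2 * (real D)\<^sup>2 / 8) * exp (l * ?p * ?Y z)" for z
  proof -
    let ?f = "\<lambda>c. num_zero D d (Suc k) (z(k := c))"
    have E: "measure_pmf.expectation ?U ?f = ?p * num_zero D d k z"
      by (rule expectation_num_zero_step[OF D d])
    \<comment> \<open>Recentring at the conditional mean leaves \<open>?p * ?Y z\<close>, since the
      overall mean also shrinks by \<open>?p\<close>; this part is constant in \<open>c\<close> and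
      factors out.\<close>
    have "measure_pmf.expectation ?U (\<lambda>c. exp (l * (?f c - expected_zero D d (Suc k)))) =
          measure_pmf.expectation ?U (\<lambda>c. exp (l * (?f c - ?p * num_zero D d k z)) *
                                            exp (l * ?p * ?Y z))"
      by (simp add: expected_zero_eq[OF D d] exp_add [symmetric] algebra_simps)
    also have "\<dots> = measure_pmf.expectation ?U
                       (\<lambda>c. exp (l * (?f c - measure_pmf.expectation ?U ?f))) * exp (l * ?p * ?Y z)"
      by (simp add: E)
    also have "\<dots> \<le> exp (l\<^sup>2 * (num_zero D d k z - (num_zero D d k z - real D))\<^sup>2 / 8) *
                        exp (l * ?p * ?Y z)"
      using num_zero_step_bounds d
      by (intro mult_right_mono Hoeffdings_lemma_finite_pmf) (auto simp: cells_nonempty)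
    finally show ?thesis by simp
  qed
  have "measure_pmf.expectation (placement_pmf D d (Suc k))
          (\<lambda>z. exp (l * (num_zero D d (Suc k) z - expected_zero D d (Suc k))))
        \<le> measure_pmf.expectation (placement_pmf D d k)
            (\<lambda>z. exp (l\<^sup>2 * (real D)\<^sup>2 / 8) * exp (l * ?p * ?Y z))"
    unfolding expectation_placement_Suc[OF d] by (intro integral_mono int step)
  also have "\<dots> \<le> exp (l\<^sup>2 * (real D)\<^sup>2 / 8) * exp ((l * ?p)\<^sup>2 * ((real D)\<^sup>2 * ?S k) / 8)"
    using Suc.IH[of "l * ?p"] by simp
  also have "\<dots> = exp (l\<^sup>2 * ((real D)\<^sup>2 * (1 + ?p\<^sup>2 * ?S k)) / 8)"
    by (simp add: exp_add [symmetric] power_mult_distrib field_simps)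
  \<comment> \<open>The new particle contributes the term \<open>j = 0\<close>; the factor from
    \<open>l * ?p\<close> shifts the earlier terms by one.\<close>
  also have "1 + ?p\<^sup>2 * ?S k = ?S (Suc k)"
    by (subst sum.lessThan_Suc_shift) (simp add: sum_distrib_left)
  finally show ?case .
qed

section \<open>The tail bound as a function of the side length\<close>

lemma miss_prob_nonneg: "d \<ge> 1 \<Longrightarrow> miss_prob D d \<ge> 0"
  by (simp add: miss_prob_def)

lemma miss_prob_less_1: "d \<ge> 1 \<Longrightarrow> miss_prob D d < 1"
  by (simp add: miss_prob_def)

text \<open>The term \<open>j = 0\<close> is 1 even at \<open>x = 0\<close>; this keeps the sum
  positive as a denominator.\<close>

lemma geometric_sum_ge_1:
  fixes x :: real
  assumes "k \<ge> 1" and "x \<ge> 0"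
  shows "(\<Sum>j<k. x ^ j) \<ge> 1"
  using member_le_sum[of 0 "{..<k}" "\<lambda>j. x ^ j"] assms by auto

text \<open>Cancelling the positive \<open>1 - p^2\<close> leaves the reciprocal of a polynomial in
  \<open>p\<close> that is regular at \<open>p = 1\<close>, so monotonicity and limit can be read
  off.\<close>

lemma tail_bound_geometric:
  assumes "d \<ge> 1"
  shows "tail_bound D k \<delta> d =
         2 * exp (- (\<delta>\<^sup>2 / (2 * (real D)\<^sup>2 * (\<Sum>j<k. ((miss_prob D d)\<^sup>2) ^ j))))"
proof -
  let ?p = "miss_prob D d"
  have p: "1 - ?p\<^sup>2 > 0"
    using miss_prob_nonneg[OF assms] miss_prob_less_1[OF assms] by (simp add: power_less_one_iff)
  have eq: "1 - ?p ^ (2 * k) = (1 - ?p\<^sup>2) * (\<Sum>j<k. (?p\<^sup>2) ^ j)"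
    by (simp add: power_mult one_diff_power_eq)
  have "(1 - ?p\<^sup>2) / (1 - ?p ^ (2 * k)) = 1 / (\<Sum>j<k. (?p\<^sup>2) ^ j)"
    unfolding eq using p by simp
  hence "tail_bound D k \<delta> d =
         2 * exp (- (1 / (\<Sum>j<k. (?p\<^sup>2) ^ j) * (\<delta>\<^sup>2 / (2 * (real D)\<^sup>2))))"
    by (simp only: tail_bound_def)
  thus ?thesis by (simp add: mult.commute)
qed

lemma tail_bound_mono:
  assumes "D \<ge> 1" and k: "k \<ge> 1"
  shows "mono_on {1..} (tail_bound D k \<delta>)"
proof (rule mono_onI)
  fix d e :: nat assume "d \<in> {1..}" "e \<in> {1..}" and de: "d \<le> e"
  hence d: "d \<ge> 1" and e: "e \<ge> 1" by auto
  let ?S = "\<lambda>d. \<Sum>j<k. ((miss_prob D d)\<^sup>2) ^ j"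
  have "miss_prob D d \<le> miss_prob D e"
    using d e de unfolding miss_prob_def by (auto intro!: divide_left_mono power_mono)
  hence "?S d \<le> ?S e"
    using miss_prob_nonneg[OF d] by (intro sum_mono power_mono) auto
  moreover have "?S d \<ge> 1" by (rule geometric_sum_ge_1[OF k]) simp
  ultimately have "\<delta>\<^sup>2 / (2 * (real D)\<^sup>2 * ?S e) \<le> \<delta>\<^sup>2 / (2 * (real D)\<^sup>2 * ?S d)"
    using assms(1) by (intro divide_left_mono mult_left_mono mult_pos_pos) auto
  thus "tail_bound D k \<delta> d \<le> tail_bound D k \<delta> e"
    using d e by (simp add: tail_bound_geometric)
qed

text \<open>For \<open>D \<ge> 2\<close> the exponent \<open>D - 1\<close> is positive; for
  \<open>D = 1\<close> the value would be constantly 0.\<close>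

lemma miss_prob_tendsto_1:
  assumes "D \<ge> 2"
  shows "miss_prob D \<longlonglongrightarrow> 1"
proof -
  have "filterlim (\<lambda>d. real d ^ (D - 1)) at_top sequentially"
    using assms by (intro filterlim_pow_at_top filterlim_real_sequentially) auto
  hence "(\<lambda>d. 1 / real d ^ (D - 1)) \<longlonglongrightarrow> 0"
    by (intro tendsto_divide_0[OF tendsto_const] filterlim_at_top_imp_at_infinity)
  from tendsto_diff[OF tendsto_const[of 1] this] show ?thesis
    by (simp add: miss_prob_def [abs_def])
qed

lemma tail_bound_tendsto:
  assumes D: "D \<ge> 2" and k: "k \<ge> 1"
  shows "tail_bound D k \<delta> \<longlonglongrightarrow> 2 * exp (- (\<delta>\<^sup>2 / (2 * (real D)\<^sup>2 * real k)))"
proof -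
  \<comment> \<open>Each of the \<open>k\<close> summands tends to 1.\<close>
  have "(\<lambda>d. \<Sum>j<k. ((miss_prob D d)\<^sup>2) ^ j) \<longlonglongrightarrow> (\<Sum>j<k. (1\<^sup>2) ^ j)"
    by (intro tendsto_intros miss_prob_tendsto_1[OF D])
  hence "(\<lambda>d. \<Sum>j<k. ((miss_prob D d)\<^sup>2) ^ j) \<longlonglongrightarrow> real k" by simp
  hence "(\<lambda>d. 2 * exp (- (\<delta>\<^sup>2 / (2 * (real D)\<^sup>2 * (\<Sum>j<k. ((miss_prob D d)\<^sup>2) ^ j)))))
         \<longlonglongrightarrow> 2 * exp (- (\<delta>\<^sup>2 / (2 * (real D)\<^sup>2 * real k)))"
    using D k by (intro tendsto_intros) auto
  moreover have "eventually (\<lambda>d. tail_bound D k \<delta> d =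
      2 * exp (- (\<delta>\<^sup>2 / (2 * (real D)\<^sup>2 * (\<Sum>j<k. ((miss_prob D d)\<^sup>2) ^ j))))) sequentially"
    \<comment> \<open>At \<open>d = 0\<close> the quotient in \<open>tail_bound\<close> is 0/0, so
      the rewriting starts at \<open>d = 1\<close>.\<close>
    using eventually_ge_at_top[of 1] by eventually_elim (rule tail_bound_geometric)
  ultimately show ?thesis by (simp add: tendsto_cong)
qed

text \<open>
  Hoeffding's lemma uses that the increments range over an interval of length \<open>D\<close>, not
  merely that they are at most \<open>D\<close> in absolute value; this gains a factor 4 in the exponent,
  which is given away here.
\<close>

lemma num_zero_tail:
  assumes D: "D \<ge> 1" and d: "d \<ge> 1" and k: "k \<ge> 1" and \<delta>: "\<delta> > 0"
  shows "measure_pmf.prob (placement_pmf D d k)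
           {z. \<bar>num_zero D d k z - expected_zero D d k\<bar> \<ge> \<delta>} \<le> tail_bound D k \<delta> d"
proof -
  let ?S = "\<Sum>j<k. ((miss_prob D d)\<^sup>2) ^ j"
  have S: "?S \<ge> 1" by (rule geometric_sum_ge_1[OF k]) simp
  hence v: "(real D)\<^sup>2 * ?S > 0" using D by (intro mult_pos_pos) auto
  have "measure_pmf.prob (placement_pmf D d k)
          {z. \<bar>num_zero D d k z - expected_zero D d k\<bar> \<ge> \<delta>} \<le>
        2 * exp (- (2 * \<delta>\<^sup>2 / ((real D)\<^sup>2 * ?S)))"
    by (rule sub_Gaussian_tail_finite_pmf[OF finite_set_placement_pmf[OF d] v \<delta> mgf_num_zero_le[OF D d]])
  also have "\<dots> \<le> 2 * exp (- (\<delta>\<^sup>2 / (2 * ((real D)\<^sup>2 * ?S))))"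
  proof -
    have "\<delta>\<^sup>2 / (2 * ((real D)\<^sup>2 * ?S)) \<le> 2 * \<delta>\<^sup>2 / ((real D)\<^sup>2 * ?S)"
      using v by (intro frac_le) auto
    thus ?thesis by simp
  qed
  finally show ?thesis using d by (simp add: tail_bound_geometric mult.assoc)
qed

theorem proposition5p3:
  fixes D d k :: nat and \<delta> :: real
  assumes "D \<in> {2, 3}" and "d \<ge> 1" and "k \<ge> 1" and "\<delta> > 0"
  shows "expected_zero D d k = real D * real d ^ (D - 1) * miss_prob D d ^ k
    \<and> measure_pmf.prob (placement_pmf D d k)
          {z. \<bar>num_zero D d k z - expected_zero D d k\<bar> \<ge> \<delta>} \<le> tail_bound D k \<delta> d
    \<and> mono_on {1..} (tail_bound D k \<delta>)
    \<and> tail_bound D k \<delta> \<longlonglongrightarrow> 2 * exp (- (\<delta> ^ 2 / (2 * real D ^ 2 * real k)))"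
proof -
  have "D \<ge> 1" "D \<ge> 2" using assms(1) by auto
  thus ?thesis
    using assms by (intro conjI expected_zero_eq num_zero_tail tail_bound_mono tail_bound_tendsto)
qed

end
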